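(* For the resistive GLM-MHD equations, the viscous and resistive fluxes $\mathbf f^v=(\mathbf f^v_1,\mathbf f^v_2,\mathbf f^v_3)\in\mathbb R^{27}$ can be expressed through gradients of the entropy variables: for every state $\mathbf u$ with $\rho,p>0$ there is a block matrix $\mathsf K=\mathsf K(\mathbf u)\in\mathbb R^{27\times 27}$, depending only on $\mathbf u$ and not on its gradient, such that $$\mathbf f^v(\mathbf u,\vec\nabla\mathbf u)=\mathsf K\,\vec\nabla\mathbf w$$ for all values of the gradient $\vec\nabla\mathbf u$ (with $\vec\nabla\mathbf w=(\mathbf w_x,\mathbf w_y,\mathbf w_z)\in\mathbb R^{27}$ the corresponding gradient of the entropy variables), and such that $\mathsf K$ is symmetric and positive semi-definite, i.e. $\mathsf K=\mathsf K^T$ and $\mathsf q^T\mathsf K\mathsf q\ge 0$ for all $\mathsf q\in\mathbb R^{27}$.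
   Context: State: $\mathbf u=(\rho,\rho\vec v,E,\vec B,\psi)^T\in\mathbb R^9$ with density $\rho$, velocity $\vec v=(v_1,v_2,v_3)^T$, total energy $E$, magnetic field $\vec B=(B_1,B_2,B_3)^T$, and scalar $\psi$. Pressure: $p=(\gamma-1)\left(E-\tfrac12\rho\|\vec v\|^2-\tfrac12\|\vec B\|^2-\tfrac12\psi^2\right)$ with adiabatic coefficient $\gamma>1$. Physical admissibility: $\rho,p>0$. The constants $\mu_{\mathrm{NS}},\mu_{\mathrm R},\kappa,R>0$ are viscosity, resistivity, thermal conductivity and gas constant. Write $(x_1,x_2,x_3)=(x,y,z)$ and $\partial_\ell=\partial/\partial x_\ell$. The viscous flux in direction $\ell\in\{1,2,3\}$ is the vector in $\mathbb R^9$ $$\mathbf f^v_\ell=\Big(0,\ \tau_{\ell1},\tau_{\ell2},\tau_{\ell3},\ \sum_{k=1}^3\tau_{\ell k}v_k+\kappa\,\partial_\ell\Big(\frac{p}{R\rho}\Big)-\mu_{\mathrm R}\big((\vec\nabla\times\vec B)\times\vec B\big)_\ell,\ \mu_{\mathrm R}(\partial_\ell B_1-\partial_1B_\ell),\ \mu_{\mathrm R}(\partial_\ell B_2-\partial_2B_\ell),\ \mu_{\mathrm R}(\partial_\ell B_3-\partial_3B_\ell),\ 0\Big)^T,$$ with stress tensor $\tau_{\ell k}=\mu_{\mathrm{NS}}(\partial_\ell v_k+\partial_k v_\ell)-\tfrac23\mu_{\mathrm{NS}}(\vec\nabla\cdot\vec v)\delta_{\ell k}$. Entropy function: $S(\mathbf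 u)=-\frac{\rho s}{\gamma-1}$, $s=\ln(p\rho^{-\gamma})$. Entropy variables, with $\beta=\frac{\rho}{2p}$: $$\mathbf w=\frac{\partial S}{\partial\mathbf u}=\Big(\tfrac{\gamma-s}{\gamma-1}-\beta\|\vec v\|^2,\,2\beta v_1,\,2\beta v_2,\,2\beta v_3,\,-2\beta,\,2\beta B_1,\,2\beta B_2,\,2\beta B_3,\,2\beta\psi\Big)^T.$$ *)

theory Defs
  imports "HOL-Analysis.Analysis"
begin

text \<open>
  A state \<open>u\<close> has components \<open>u $ 1, \<dots>, u $ 9\<close> (the index \<open>9\<close> of the numeral type is the same
  element as \<open>0\<close>), in the order density, momentum, total energy, magnetic field, \<open>\<psi>\<close>.
  A value of the gradient of the state is some \<open>g\<close> of type \<^typ>\<open>real^9^3\<close>,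
  where \<open>g $ l\<close> stands for the derivative of the state in direction \<open>x\<^sub>l\<close>.
\<close>

definition density :: "real^9 \<Rightarrow> real" where
  "density u = u $ 1"

definition velocity :: "real^9 \<Rightarrow> real^3" where
  "velocity u = vector [u $ 2 / u $ 1, u $ 3 / u $ 1, u $ 4 / u $ 1]"

definition energy :: "real^9 \<Rightarrow> real" where
  "energy u = u $ 5"

definition magnetic :: "real^9 \<Rightarrow> real^3" where
  "magnetic u = vector [u $ 6, u $ 7, u $ 8]"

definition psi :: "real^9 \<Rightarrow> real" where
  "psi u = u $ 9"

definition pressure :: "real \<Rightarrow> real^9 \<Rightarrow> real" where
  "pressure \<gamma> u = (\<gamma> - 1) * (energy u - 1/2 * density u * (norm (velocity u))\<^sup>2
                       - 1/2 * (norm (magnetic u))\<^sup>2 - 1/2 * (psi u)\<^sup>2)"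

definition admissible :: "real \<Rightarrow> real^9 \<Rightarrow> bool" where
  "admissible \<gamma> u \<longleftrightarrow> density u > 0 \<and> pressure \<gamma> u > 0"

text \<open>
  The derivative in direction \<open>x\<^sub>l\<close> of a quantity \<open>\<phi>(u)\<close>, as a function of the values of the state
  and of its gradient; see lemma \<open>pd_field\<close> for the link with partial derivatives of fields.
\<close>

definition pd :: "(real^9 \<Rightarrow> 'b::real_normed_vector) \<Rightarrow> real^9 \<Rightarrow> real^9^3 \<Rightarrow> 3 \<Rightarrow> 'b" where
  "pd \<phi> u g l = frechet_derivative \<phi> (at u) (g $ l)"

lemma pd_field:
  fixes U :: "real^3 \<Rightarrow> real^9" and \<phi> :: "real^9 \<Rightarrow> 'b::real_normed_vector"
  assumes "U differentiable (at x)" and "\<phi> differentiable (at (U x))"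
  shows "frechet_derivative (\<lambda>y. \<phi> (U y)) (at x) (axis l 1)
       = pd \<phi> (U x) (\<chi> k. frechet_derivative U (at x) (axis k 1)) l"
proof -
  have "frechet_derivative (\<phi> \<circ> U) (at x)
      = frechet_derivative \<phi> (at (U x)) \<circ> frechet_derivative U (at x)"
    by (rule frechet_derivative_compose) (use assms in auto)
  then show ?thesis by (simp add: pd_def o_def)
qed

definition div_velocity :: "real^9 \<Rightarrow> real^9^3 \<Rightarrow> real" where
  "div_velocity u g = (\<Sum>k\<in>UNIV. pd (\<lambda>u. velocity u $ k) u g k)"

definition curl_magnetic :: "real^9 \<Rightarrow> real^9^3 \<Rightarrow> real^3" where
  "curl_magnetic u g = (let dB = (\<lambda>l k. pd (\<lambda>u. magnetic u $ k) u g l) in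
     vector [dB 2 3 - dB 3 2, dB 3 1 - dB 1 3, dB 1 2 - dB 2 1])"

definition stress :: "real \<Rightarrow> real^9 \<Rightarrow> real^9^3 \<Rightarrow> 3 \<Rightarrow> 3 \<Rightarrow> real" where
  "stress \<mu>NS u g l k =
     \<mu>NS * (pd (\<lambda>u. velocity u $ k) u g l + pd (\<lambda>u. velocity u $ l) u g k)
     - 2/3 * \<mu>NS * div_velocity u g * (if l = k then 1 else 0)"

definition viscous_flux_dir ::
  "real \<Rightarrow> real \<Rightarrow> real \<Rightarrow> real \<Rightarrow> real \<Rightarrow> real^9 \<Rightarrow> real^9^3 \<Rightarrow> 3 \<Rightarrow> real^9" where
  "viscous_flux_dir \<gamma> \<mu>NS \<mu>R \<kappa> R u g l =
     (let \<tau> = stress \<mu>NS u g; dB = (\<lambda>l k. pd (\<lambda>u. magnetic u $ k) u g l) in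
      vector
       [0,
        \<tau> l 1, \<tau> l 2, \<tau> l 3,
        (\<Sum>k\<in>UNIV. \<tau> l k * velocity u $ k)
          + \<kappa> * pd (\<lambda>u. pressure \<gamma> u / (R * density u)) u g l
          - \<mu>R * cross3 (curl_magnetic u g) (magnetic u) $ l,
        \<mu>R * (dB l 1 - dB 1 l), \<mu>R * (dB l 2 - dB 2 l), \<mu>R * (dB l 3 - dB 3 l),
        0])"

text \<open>
  The space \<open>\<real>\<^sup>2\<^sup>7\<close> is \<^typ>\<open>real^(3 \<times> 9)\<close>: the first index is the direction (the block),
  the second one the component within the block.
\<close>

definition stack :: "real^9^3 \<Rightarrow> real^(3 \<times> 9)" where
  "stack a = (\<chi> i. a $ fst i $ snd i)"

definition viscous_flux ::
  "real \<Rightarrow> real \<Rightarrow> real \<Rightarrow> real \<Rightarrow> real \<Rightarrow> real^9 \<Rightarrow> real^9^3 \<Rightarrow> real^(3 \<times> 9)" where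
  "viscous_flux \<gamma> \<mu>NS \<mu>R \<kappa> R u g = stack (\<chi> l. viscous_flux_dir \<gamma> \<mu>NS \<mu>R \<kappa> R u g l)"

definition spec_entropy :: "real \<Rightarrow> real^9 \<Rightarrow> real" where
  "spec_entropy \<gamma> u = ln (pressure \<gamma> u * density u powr (- \<gamma>))"

definition entropy :: "real \<Rightarrow> real^9 \<Rightarrow> real" where
  "entropy \<gamma> u = - (density u * spec_entropy \<gamma> u / (\<gamma> - 1))"

definition entropy_vars :: "real \<Rightarrow> real^9 \<Rightarrow> real^9" where
  "entropy_vars \<gamma> u = (\<chi> i. frechet_derivative (entropy \<gamma>) (at u) (axis i 1))"

definition grad_entropy_vars :: "real \<Rightarrow> real^9 \<Rightarrow> real^9^3 \<Rightarrow> real^(3 \<times> 9)" where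
  "grad_entropy_vars \<gamma> u g = stack (\<chi> l. pd (entropy_vars \<gamma>) u g l)"

lemma exhaust_9:
  fixes x :: 9
  shows "x = 1 \<or> x = 2 \<or> x = 3 \<or> x = 4 \<or> x = 5 \<or> x = 6 \<or> x = 7 \<or> x = 8 \<or> x = 9"
proof (induct x)
  case (of_int z)
  then have "z = 0 \<or> z = 1 \<or> z = 2 \<or> z = 3 \<or> z = 4 \<or> z = 5 \<or> z = 6 \<or> z = 7 \<or> z = 8"
    by (simp, arith)
  then show ?case by auto
qed

lemma forall_9:
  "(\<forall>i::9. P i) \<longleftrightarrow> P 1 \<and> P 2 \<and> P 3 \<and> P 4 \<and> P 5 \<and> P 6 \<and> P 7 \<and> P 8 \<and> P 9"
  by (metis exhaust_9)

lemma vector_9: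
  fixes a b c d e f g h i :: "'a::zero"
  defines "w \<equiv> (vector [a,b,c,d,e,f,g,h,i] :: 'a^9)"
  shows "w $ 1 = a" "w $ 2 = b" "w $ 3 = c" "w $ 4 = d" "w $ 5 = e"
        "w $ 6 = f" "w $ 7 = g" "w $ 8 = h" "w $ 9 = i"
  unfolding w_def vector_def by simp_all

lemma pressure_expand:
  "u $ 1 \<noteq> 0 \<Longrightarrow> pressure \<gamma> u = (\<gamma> - 1) * (u $ 5
     - 1/2 * (((u $ 2)\<^sup>2 + (u $ 3)\<^sup>2 + (u $ 4)\<^sup>2) / u $ 1)
     - 1/2 * ((u $ 6)\<^sup>2 + (u $ 7)\<^sup>2 + (u $ 8)\<^sup>2) - 1/2 * (u $ 9)\<^sup>2)"
  unfolding pressure_def energy_def density_def velocity_def magnetic_def psi_def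
    power2_norm_eq_inner inner_vec_def sum_3 vector_3
  by (simp add: field_simps power2_eq_square)

lemma has_derivative_pressure:
  assumes "u $ 1 \<noteq> 0"
  shows "(pressure \<gamma> has_derivative (\<lambda>h. (\<gamma> - 1) * (h $ 5
     - ((u $ 2 * h $ 2 + u $ 3 * h $ 3 + u $ 4 * h $ 4) / u $ 1)
     + 1/2 * (((u $ 2)\<^sup>2 + (u $ 3)\<^sup>2 + (u $ 4)\<^sup>2) / (u $ 1)\<^sup>2) * h $ 1
     - (u $ 6 * h $ 6 + u $ 7 * h $ 7 + u $ 8 * h $ 8) - u $ 9 * h $ 9))) (at u)"
    (is "(_ has_derivative ?D) _")
proof -
  let ?f = "\<lambda>u::real^9. (\<gamma> - 1) * (u $ 5
     - 1/2 * (((u $ 2)\<^sup>2 + (u $ 3)\<^sup>2 + (u $ 4)\<^sup>2) / u $ 1)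
     - 1/2 * ((u $ 6)\<^sup>2 + (u $ 7)\<^sup>2 + (u $ 8)\<^sup>2) - 1/2 * (u $ 9)\<^sup>2)"
  have "(?f has_derivative ?D) (at u)"
    using assms
    by (auto intro!: derivative_eq_intros bounded_linear.has_derivative[OF bounded_linear_vec_nth]
        simp: field_simps power2_eq_square)
  moreover have "open {v::real^9. v $ 1 \<noteq> 0}"
    by (intro open_Collect_neq continuous_intros)
  ultimately show ?thesis
    by (rule has_derivative_transform_within_open) (use assms in \<open>auto simp: pressure_expand\<close>)
qed

lemma open_admissible: "open {u. admissible \<gamma> u}"
proof -
  have "continuous_on {u. u $ 1 > 0} (pressure \<gamma>)"
    by (intro continuous_at_imp_continuous_on ballI has_derivative_continuous)
       (auto intro!: has_derivative_pressure)
  moreover have "open {u::real^9. u $ 1 > 0}"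
    by (intro open_Collect_less continuous_intros)
  ultimately have "open ({u. u $ 1 > 0} \<inter> pressure \<gamma> -` {0<..})"
    by (simp add: continuous_on_open_vimage[symmetric] continuous_open_preimage)
  also have "{u. u $ 1 > 0} \<inter> pressure \<gamma> -` {0<..} = {u. admissible \<gamma> u}"
    by (auto simp: admissible_def density_def)
  finally show ?thesis .
qed

lemma entropy_vars_explicit:
  assumes "\<gamma> > 1" and "admissible \<gamma> u"
  defines "\<beta> \<equiv> density u / (2 * pressure \<gamma> u)"
  shows "entropy_vars \<gamma> u = vector
     [(\<gamma> - spec_entropy \<gamma> u) / (\<gamma> - 1) - \<beta> * (norm (velocity u))\<^sup>2,
      2 * \<beta> * velocity u $ 1, 2 * \<beta> * velocity u $ 2, 2 * \<beta> * velocity u $ 3,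
      - 2 * \<beta>,
      2 * \<beta> * magnetic u $ 1, 2 * \<beta> * magnetic u $ 2, 2 * \<beta> * magnetic u $ 3,
      2 * \<beta> * psi u]"
proof -
  define c where "c = 1 / (\<gamma> - 1)"
  let ?S = "\<lambda>u. - (u $ 1 * (ln (pressure \<gamma> u) - \<gamma> * ln (u $ 1)) * c)"
  have eq: "entropy \<gamma> v = ?S v" and eq': "spec_entropy \<gamma> v = ln (pressure \<gamma> v) - \<gamma> * ln (v $ 1)"
    if "admissible \<gamma> v" for v
    using that by (auto simp: entropy_def spec_entropy_def admissible_def density_def ln_mult ln_powr c_def)
  have r: "u $ 1 > 0" and p: "pressure \<gamma> u > 0"
    using assms(2) by (auto simp: admissible_def density_def)
  define D where "D = (\<lambda>h::real^9. (\<gamma> - 1) * (h $ 5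
     - ((u $ 2 * h $ 2 + u $ 3 * h $ 3 + u $ 4 * h $ 4) / u $ 1)
     + 1/2 * (((u $ 2)\<^sup>2 + (u $ 3)\<^sup>2 + (u $ 4)\<^sup>2) / (u $ 1)\<^sup>2) * h $ 1
     - (u $ 6 * h $ 6 + u $ 7 * h $ 7 + u $ 8 * h $ 8) - u $ 9 * h $ 9))"
  have dp: "(pressure \<gamma> has_derivative D) (at u)"
    unfolding D_def using r by (intro has_derivative_pressure) auto
  define DS where "DS = (\<lambda>h::real^9. - ((h $ 1 * spec_entropy \<gamma> u
      + u $ 1 * (D h / pressure \<gamma> u) - \<gamma> * h $ 1) * c))"
  have "(?S has_derivative DS) (at u)"
    using r p
    by (auto intro!: derivative_eq_intros bounded_linear.has_derivative[OF bounded_linear_vec_nth] dp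
        simp: DS_def eq'[OF assms(2)] fun_eq_iff field_simps)
  then have "(entropy \<gamma> has_derivative DS) (at u)"
    by (rule has_derivative_transform_within_open[OF _ open_admissible[of \<gamma>]])
       (use assms(2) eq in auto)
  then have DS: "frechet_derivative (entropy \<gamma>) (at u) = DS"
    by (simp add: frechet_derivative_at[symmetric])
  have nv: "(norm (velocity u))\<^sup>2 = ((u $ 2)\<^sup>2 + (u $ 3)\<^sup>2 + (u $ 4)\<^sup>2) / (u $ 1)\<^sup>2"
    unfolding power2_norm_eq_inner inner_vec_def sum_3 velocity_def vector_3
    by (simp add: power2_eq_square add_divide_distrib)
  have g: "\<gamma> - 1 \<noteq> 0"
    using assms(1) by simp
  have DS': "DS h = (\<gamma> - spec_entropy \<gamma> u) / (\<gamma> - 1) * h $ 1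
      - u $ 1 / pressure \<gamma> u * (D h / (\<gamma> - 1))" for h
    using p g unfolding DS_def c_def by (simp add: divide_simps) (simp add: algebra_simps)
  have D': "D h / (\<gamma> - 1) = h $ 5
     - ((u $ 2 * h $ 2 + u $ 3 * h $ 3 + u $ 4 * h $ 4) / u $ 1)
     + 1/2 * (((u $ 2)\<^sup>2 + (u $ 3)\<^sup>2 + (u $ 4)\<^sup>2) / (u $ 1)\<^sup>2) * h $ 1
     - (u $ 6 * h $ 6 + u $ 7 * h $ 7 + u $ 8 * h $ 8) - u $ 9 * h $ 9" for h
    using g unfolding D_def by simp
  show ?thesis
    unfolding entropy_vars_def DS vec_eq_iff forall_9 vector_9 nv DS' D' \<beta>_def
    using r p
    by (simp add: axis_def density_def velocity_def magnetic_def psi_def vector_3)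
qed

end

theory Submission
  imports Defs
begin

text \<open>
  The entropy variables determine the primitive quantities rationally:
  \<open>v\<^sub>k = - w\<^sub>k\<^sub>+\<^sub>1 / w\<^sub>5\<close>, \<open>B\<^sub>k = - w\<^sub>k\<^sub>+\<^sub>5 / w\<^sub>5\<close> and \<open>\<theta> = p / \<rho> = - 1 / w\<^sub>5\<close>. The quotient rule therefore gives
  \<open>\<partial>v\<^sub>k = \<theta> (\<partial>w\<^sub>k\<^sub>+\<^sub>1 + v\<^sub>k \<partial>w\<^sub>5)\<close>, \<open>\<partial>B\<^sub>k = \<theta> (\<partial>w\<^sub>k\<^sub>+\<^sub>5 + B\<^sub>k \<partial>w\<^sub>5)\<close> and \<open>\<partial>\<theta> = \<theta>\<^sup>2 \<partial>w\<^sub>5\<close>.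
  Only these three kinds of gradients enter the viscous flux, so the flux is \<open>F (\<nabla>w)\<close> for a map
  \<open>F\<close> on \<open>\<real>\<^sup>2\<^sup>7\<close> whose coefficients depend on \<open>u\<close> alone (\<open>viscous_flux_eq_flux_map\<close>).

  Test \<open>F q\<close> against \<open>r\<close>. In the energy component the flux carries the stress multiplied by
  \<open>v\<close> and the resistive flux multiplied by \<open>B\<close>. These terms complete the components of \<open>r\<close> to the same
  combinations \<open>G\<^sub>l\<^sub>k = q\<^sub>l\<^sub>,\<^sub>k\<^sub>+\<^sub>1 + v\<^sub>k q\<^sub>l\<^sub>,\<^sub>5\<close> and \<open>H\<^sub>l\<^sub>k = q\<^sub>l\<^sub>,\<^sub>k\<^sub>+\<^sub>5 + B\<^sub>k q\<^sub>l\<^sub>,\<^sub>5\<close> that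
  the flux is built from (\<open>inner_flux_map\<close>). Hence \<open>r \<bullet> F q\<close> is a sum of three symmetric
  bilinear forms: the viscous form pairs the trace-free symmetric parts of \<open>G\<close>, the resistive
  form pairs the antisymmetric parts of \<open>H\<close>, and the thermal form is a multiple of
  \<open>\<Sum>\<^sub>l q\<^sub>l\<^sub>,\<^sub>5 r\<^sub>l\<^sub>,\<^sub>5\<close>. Each of them is positive semi-definite with a nonnegative coefficient,
  and \<open>K\<close> is the matrix of \<open>F\<close>.
\<close>

section \<open>Matrices of positive symmetric forms\<close>

text \<open>
  Self-adjointness already forces linearity, because \<open>r \<bullet> F q = q \<bullet> F r\<close> is linear in \<open>q\<close>.
\<close>

lemma self_adjoint_imp_linear:
  fixes F :: "'a::real_inner \<Rightarrow> 'a"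
  assumes sym: "\<And>q r. r \<bullet> F q = q \<bullet> F r"
  shows "linear F"
proof (rule linearI)
  show "F (x + y) = F x + F y" for x y
  proof (rule vector_eq_ldot[THEN iffD1], rule allI)
    show "z \<bullet> F (x + y) = z \<bullet> (F x + F y)" for z
      using sym[of "x + y" z] sym[of x z] sym[of y z] by (simp add: inner_add_left inner_add_right)
  qed
  show "F (c *\<^sub>R x) = c *\<^sub>R F x" for c x
  proof (rule vector_eq_ldot[THEN iffD1], rule allI)
    show "z \<bullet> F (c *\<^sub>R x) = z \<bullet> (c *\<^sub>R F x)" for z
      using sym[of "c *\<^sub>R x" z] sym[of x z] by simp
  qed
qed

lemma psd_matrix_of_self_adjoint:
  fixes F :: "real^'n \<Rightarrow> real^'n"
  assumes sym: "\<And>q r. r \<bullet> F q = q \<bullet> F r" and pos: "\<And>q. q \<bullet> F q \<ge> 0"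
  shows "\<exists>K. (\<forall>q. K *v q = F q) \<and> K = transpose K \<and> (\<forall>q. q \<bullet> (K *v q) \<ge> 0)"
proof (intro exI conjI allI)
  have lin: "linear F"
    using sym by (rule self_adjoint_imp_linear)
  show K: "matrix F *v q = F q" for q
    using lin by simp
  show "matrix F = transpose (matrix F)"
    using sym[of "axis _ 1" "axis _ 1"]
    by (simp add: vec_eq_iff transpose_def matrix_def inner_axis')
  show "q \<bullet> (matrix F *v q) \<ge> 0" for q
    using pos K by simp
qed

section \<open>The viscous and the resistive form\<close>

definition newtonian :: "(3 \<Rightarrow> 3 \<Rightarrow> real) \<Rightarrow> 3 \<Rightarrow> 3 \<Rightarrow> real" where
  "newtonian G l k = G l k + G k l - 2/3 * (\<Sum>m\<in>UNIV. G m m) * (if l = k then 1 else 0)"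

definition skew :: "(3 \<Rightarrow> 3 \<Rightarrow> real) \<Rightarrow> 3 \<Rightarrow> 3 \<Rightarrow> real" where
  "skew H l k = H l k - H k l"

lemma newtonian_form_sym:
  "(\<Sum>l\<in>UNIV. \<Sum>k\<in>UNIV. newtonian G l k * G' l k)
     = (\<Sum>l\<in>UNIV. \<Sum>k\<in>UNIV. newtonian G' l k * G l k)"
  by (simp add: newtonian_def sum_3 algebra_simps)

text \<open>
  The off-diagonal part is a sum of squares of \<open>G\<^sub>l\<^sub>k + G\<^sub>k\<^sub>l\<close>. The diagonal part is
  \<open>2 \<Sum> G\<^sub>m\<^sub>m\<^sup>2 - 2/3 (\<Sum> G\<^sub>m\<^sub>m)\<^sup>2\<close>, two thirds of the sum of the squared differences of
  the diagonal entries: in three dimensions the factor \<open>2/3\<close> removes exactly the trace.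
\<close>

lemma newtonian_form_nonneg:
  "(\<Sum>l\<in>UNIV. \<Sum>k\<in>UNIV. newtonian G l k * G l k) \<ge> 0"
proof -
  have "(\<Sum>l\<in>UNIV. \<Sum>k\<in>UNIV. newtonian G l k * G l k)
      = 2/3 * ((G 1 1 - G 2 2)\<^sup>2 + (G 2 2 - G 3 3)\<^sup>2 + (G 3 3 - G 1 1)\<^sup>2)
        + (G 1 2 + G 2 1)\<^sup>2 + (G 2 3 + G 3 2)\<^sup>2 + (G 1 3 + G 3 1)\<^sup>2"
    by (simp add: newtonian_def sum_3 power2_eq_square algebra_simps)
  then show ?thesis by simp
qed

lemma skew_form_sym:
  "(\<Sum>l\<in>UNIV. \<Sum>k\<in>UNIV. skew H l k * H' l k)
     = (\<Sum>l\<in>UNIV. \<Sum>k\<in>UNIV. skew H' l k * H l k)"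
  by (simp add: skew_def sum_3 algebra_simps)

lemma skew_form_nonneg:
  "(\<Sum>l\<in>UNIV. \<Sum>k\<in>UNIV. skew H l k * H l k) \<ge> 0"
proof -
  have "(\<Sum>l\<in>UNIV. \<Sum>k\<in>UNIV. skew H l k * H l k)
      = (H 1 2 - H 2 1)\<^sup>2 + (H 2 3 - H 3 2)\<^sup>2 + (H 1 3 - H 3 1)\<^sup>2"
    by (simp add: skew_def sum_3 power2_eq_square algebra_simps)
  then show ?thesis by simp
qed

section \<open>The flux as a map of the gradient of the entropy variables\<close>

definition momentum :: "real^9 \<Rightarrow> real^3" where
  "momentum a = vector [a $ 2, a $ 3, a $ 4]"

definition block :: "real^(3 \<times> 9) \<Rightarrow> 3 \<Rightarrow> real^9" where
  "block q l = (\<chi> i. q $ (l, i))"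

text \<open>
  For \<open>q = \<nabla>w\<close>, and for the velocity and the magnetic field of the same state, \<open>p / \<rho>\<close> times
  these expressions are the gradients \<open>\<partial>\<^sub>l v\<^sub>k\<close> and \<open>\<partial>\<^sub>l B\<^sub>k\<close>.
\<close>

definition vel_grad :: "real^3 \<Rightarrow> real^(3 \<times> 9) \<Rightarrow> 3 \<Rightarrow> 3 \<Rightarrow> real" where
  "vel_grad v q l k = momentum (block q l) $ k + v $ k * block q l $ 5"

definition mag_grad :: "real^3 \<Rightarrow> real^(3 \<times> 9) \<Rightarrow> 3 \<Rightarrow> 3 \<Rightarrow> real" where
  "mag_grad B q l k = magnetic (block q l) $ k + B $ k * block q l $ 5"

definition flux_map ::
  "real \<Rightarrow> real \<Rightarrow> real \<Rightarrow> real^3 \<Rightarrow> real^3 \<Rightarrow> real^(3 \<times> 9) \<Rightarrow> real^(3 \<times> 9)" where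
  "flux_map a b c v B q = stack (\<chi> l.
     let \<tau> = (\<lambda>k. a * newtonian (vel_grad v q) l k);
         j = (\<lambda>k. b * skew (mag_grad B q) l k)
     in vector [0, \<tau> 1, \<tau> 2, \<tau> 3,
          (\<Sum>k\<in>UNIV. \<tau> k * v $ k) + c * block q l $ 5 + (\<Sum>k\<in>UNIV. j k * B $ k),
          j 1, j 2, j 3, 0])"

lemma sum_9:
  fixes f :: "9 \<Rightarrow> real"
  shows "sum f UNIV = f 1 + f 2 + f 3 + f 4 + f 5 + f 6 + f 7 + f 8 + f 9"
proof -
  let ?xs = "[1, 2, 3, 4, 5, 6, 7, 8, 9] :: 9 list"
  have set: "set ?xs = UNIV"
    using exhaust_9 by auto
  \<comment> \<open>Nine numerals that exhaust a type with nine elements are pairwise distinct.\<close>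
  have "distinct ?xs"
    by (rule card_distinct, unfold set) simp
  then have "sum f (set ?xs) = sum_list (map f ?xs)"
    by (rule sum_list_distinct_conv_sum_set[symmetric])
  then show ?thesis
    unfolding set by (simp only: list.map sum_list.Cons sum_list.Nil add_0_right add.assoc)
qed

lemma inner_stack:
  "r \<bullet> stack a = (\<Sum>l\<in>UNIV. block r l \<bullet> a $ l)"
  by (simp add: inner_vec_def stack_def block_def UNIV_Times_UNIV[symmetric]
      sum.cartesian_product case_prod_beta del: UNIV_Times_UNIV)

lemma inner_9:
  fixes a b :: "real^9"
  shows "a \<bullet> b = a $ 1 * b $ 1 + a $ 2 * b $ 2 + a $ 3 * b $ 3 + a $ 4 * b $ 4 + a $ 5 * b $ 5
    + a $ 6 * b $ 6 + a $ 7 * b $ 7 + a $ 8 * b $ 8 + a $ 9 * b $ 9"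
  by (simp only: inner_vec_def inner_real_def sum_9)

text \<open>
  Multiplied by \<open>r\<^sub>l\<^sub>,\<^sub>5\<close>, the work of the stress and the Joule term in the energy component
  supply the summands \<open>v\<^sub>k r\<^sub>l\<^sub>,\<^sub>5\<close> and \<open>B\<^sub>k r\<^sub>l\<^sub>,\<^sub>5\<close> of \<open>vel_grad\<close> and \<open>mag_grad\<close>.
\<close>

lemma inner_flux_map:
  "r \<bullet> flux_map a b c v B q
     = a * (\<Sum>l\<in>UNIV. \<Sum>k\<in>UNIV. newtonian (vel_grad v q) l k * vel_grad v r l k)
     + b * (\<Sum>l\<in>UNIV. \<Sum>k\<in>UNIV. skew (mag_grad B q) l k * mag_grad B r l k)
     + c * (\<Sum>l\<in>UNIV. block q l $ 5 * block r l $ 5)"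
proof -
  have blockwise: "x \<bullet> vector [0, t 1, t 2, t 3,
        (\<Sum>k\<in>UNIV. t k * v $ k) + e + (\<Sum>k\<in>UNIV. j k * B $ k), j 1, j 2, j 3, 0]
      = (\<Sum>k\<in>UNIV. t k * (momentum x $ k + v $ k * x $ 5))
        + (\<Sum>k\<in>UNIV. j k * (magnetic x $ k + B $ k * x $ 5)) + e * x $ 5"
    for x :: "real^9" and t j :: "3 \<Rightarrow> real" and e
    by (simp add: inner_9 vector_9 momentum_def magnetic_def sum_3 vector_3 algebra_simps)
  have "block r l \<bullet> (let \<tau> = (\<lambda>k. a * newtonian (vel_grad v q) l k);
        j = (\<lambda>k. b * skew (mag_grad B q) l k)
      in vector [0, \<tau> 1, \<tau> 2, \<tau> 3,
          (\<Sum>k\<in>UNIV. \<tau> k * v $ k) + c * block q l $ 5 + (\<Sum>k\<in>UNIV. j k * B $ k),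
          j 1, j 2, j 3, 0])
      = (\<Sum>k\<in>UNIV. a * newtonian (vel_grad v q) l k * vel_grad v r l k)
        + (\<Sum>k\<in>UNIV. b * skew (mag_grad B q) l k * mag_grad B r l k)
        + c * block q l $ 5 * block r l $ 5" for l
    unfolding Let_def vel_grad_def[of _ r] mag_grad_def[of _ r]
    by (rule blockwise[where t = "\<lambda>k. a * newtonian (vel_grad v q) l k"
          and j = "\<lambda>k. b * skew (mag_grad B q) l k"])
  then show ?thesis
    unfolding flux_map_def inner_stack vec_lambda_beta
    by (simp only: sum.distrib sum_distrib_left mult.assoc)
qed

lemma flux_map_self_adjoint:
  "r \<bullet> flux_map a b c v B q = q \<bullet> flux_map a b c v B r"
  unfolding inner_flux_map
  by (subst newtonian_form_sym, subst skew_form_sym) (simp add: mult.commute)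

lemma flux_map_nonneg:
  assumes "a \<ge> 0" "b \<ge> 0" "c \<ge> 0"
  shows "q \<bullet> flux_map a b c v B q \<ge> 0"
  unfolding inner_flux_map
  by (intro add_nonneg_nonneg mult_nonneg_nonneg[OF assms(1)] mult_nonneg_nonneg[OF assms(2)]
      mult_nonneg_nonneg[OF assms(3)] newtonian_form_nonneg skew_form_nonneg sum_nonneg
      zero_le_square)

section \<open>Derivatives in terms of the entropy variables\<close>

lemma entropy_vars_primitive:
  assumes "\<gamma> > 1" and "admissible \<gamma> u"
  shows "entropy_vars \<gamma> u $ 5 = - (density u / pressure \<gamma> u)"
    and "velocity u $ k = - (momentum (entropy_vars \<gamma> u) $ k / entropy_vars \<gamma> u $ 5)"
    and "magnetic u $ k = - (magnetic (entropy_vars \<gamma> u) $ k / entropy_vars \<gamma> u $ 5)"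
proof -
  have r: "density u > 0" and p: "pressure \<gamma> u > 0"
    using assms(2) by (auto simp: admissible_def)
  note w = entropy_vars_explicit[OF assms] vector_9
  show "entropy_vars \<gamma> u $ 5 = - (density u / pressure \<gamma> u)"
    by (simp add: w)
  show "velocity u $ k = - (momentum (entropy_vars \<gamma> u) $ k / entropy_vars \<gamma> u $ 5)"
    using exhaust_3[of k] r p by (auto simp: w momentum_def vector_3)
  have "magnetic (entropy_vars \<gamma> u) = (density u / pressure \<gamma> u) *\<^sub>R magnetic u"
    by (simp add: w magnetic_def vec_eq_iff forall_3 vector_3)
  then show "magnetic u $ k = - (magnetic (entropy_vars \<gamma> u) $ k / entropy_vars \<gamma> u $ 5)"
    using r p by (simp add: w)
qed

lemma entropy_vars_differentiable:
  assumes "\<gamma> > 1" and "admissible \<gamma> u"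
  shows "entropy_vars \<gamma> differentiable (at u)"
proof -
  have r: "u $ 1 > 0" and p: "pressure \<gamma> u > 0"
    using assms(2) by (auto simp: admissible_def density_def)
  have dp: "pressure \<gamma> differentiable (at u)"
    using has_derivative_pressure[of u \<gamma>] r unfolding differentiable_def by auto
  have nth: "(\<lambda>v::real^9. v $ i) differentiable (at u)" for i
    by (rule bounded_linear_imp_differentiable[OF bounded_linear_vec_nth])
  have ln_diff: "(\<lambda>v. ln (f v)) differentiable (at u)"
    if "f differentiable (at u)" "f u > 0" for f :: "real^9 \<Rightarrow> real"
    using that unfolding differentiable_def by (blast intro: has_derivative_ln)
  \<comment> \<open>The entropy variables as rational expressions and logarithms in the conservative variables;
     the power of the density is replaced by a logarithm.\<close>
  define f where "f = (\<lambda>v::real^9. vector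
     [(\<gamma> - (ln (pressure \<gamma> v) - \<gamma> * ln (v $ 1))) / (\<gamma> - 1)
        - v $ 1 / (2 * pressure \<gamma> v) * ((v $ 2 / v $ 1)\<^sup>2 + (v $ 3 / v $ 1)\<^sup>2 + (v $ 4 / v $ 1)\<^sup>2),
      2 * (v $ 1 / (2 * pressure \<gamma> v)) * (v $ 2 / v $ 1),
      2 * (v $ 1 / (2 * pressure \<gamma> v)) * (v $ 3 / v $ 1),
      2 * (v $ 1 / (2 * pressure \<gamma> v)) * (v $ 4 / v $ 1),
      - 2 * (v $ 1 / (2 * pressure \<gamma> v)),
      2 * (v $ 1 / (2 * pressure \<gamma> v)) * v $ 6,
      2 * (v $ 1 / (2 * pressure \<gamma> v)) * v $ 7,
      2 * (v $ 1 / (2 * pressure \<gamma> v)) * v $ 8,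
      2 * (v $ 1 / (2 * pressure \<gamma> v)) * v $ 9] :: real^9)"
  have f: "f v = entropy_vars \<gamma> v" if "admissible \<gamma> v" for v
  proof -
    have "spec_entropy \<gamma> v = ln (pressure \<gamma> v) - \<gamma> * ln (v $ 1)"
      using that by (auto simp: spec_entropy_def admissible_def density_def ln_mult ln_powr)
    moreover have "(norm (velocity v))\<^sup>2 = (v $ 2 / v $ 1)\<^sup>2 + (v $ 3 / v $ 1)\<^sup>2 + (v $ 4 / v $ 1)\<^sup>2"
      unfolding power2_norm_eq_inner inner_vec_def sum_3 velocity_def vector_3
      by (simp add: power2_eq_square)
    ultimately show ?thesis
      unfolding entropy_vars_explicit[OF assms(1) that] f_def
      by (simp add: density_def velocity_def magnetic_def psi_def vector_3)
  qed
  have "(\<lambda>v. f v $ i) differentiable (at u)" for i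
  proof -
    have "\<forall>i. (\<lambda>v. f v $ i) differentiable (at u)"
      unfolding forall_9 f_def vector_9 using r p assms(1)
      by (intro conjI differentiable_add differentiable_diff differentiable_minus
          differentiable_mult differentiable_divide differentiable_power differentiable_const
          dp nth ln_diff) auto
    then show ?thesis by blast
  qed
  then have "f differentiable (at u)"
    by (subst differentiable_componentwise_within)
       (auto simp: Basis_vec_def inner_axis)
  then obtain D where "(f has_derivative D) (at u)"
    unfolding differentiable_def by blast
  then have "(entropy_vars \<gamma> has_derivative D) (at u)"
    by (rule has_derivative_transform_within_open[OF _ open_admissible[of \<gamma>]])
       (use assms(2) f in auto)
  then show ?thesis
    unfolding differentiable_def by blast
qed

text \<open>
  The quotient rule, with denominator \<open>w\<^sub>5 = - \<rho> / p\<close>. For the velocity and the magnetic field,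
  \<open>L\<close> selects the component of \<open>w\<close> that carries \<open>2 \<beta> \<phi>\<close>. The result multiplies \<open>\<nabla>w\<close> by
  coefficients that depend on \<open>u\<close> alone.
\<close>

lemma pd_quotient_of_entropy_vars:
  fixes \<phi> :: "real^9 \<Rightarrow> real" and L :: "real^9 \<Rightarrow> real"
  assumes "\<gamma> > 1" and "admissible \<gamma> u" and L: "bounded_linear L"
    and \<phi>: "\<And>v. admissible \<gamma> v \<Longrightarrow> \<phi> v = - (L (entropy_vars \<gamma> v) / entropy_vars \<gamma> v $ 5)"
  shows "pd \<phi> u g l = pressure \<gamma> u / density u
    * (L (pd (entropy_vars \<gamma>) u g l) + \<phi> u * pd (entropy_vars \<gamma>) u g l $ 5)"
proof -
  define W where "W = frechet_derivative (entropy_vars \<gamma>) (at u)"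
  have W: "(entropy_vars \<gamma> has_derivative W) (at u)"
    using entropy_vars_differentiable[OF assms(1,2)] unfolding W_def frechet_derivative_works .
  have r: "density u > 0" and p: "pressure \<gamma> u > 0"
    using assms(2) by (auto simp: admissible_def)
  note w5 = entropy_vars_primitive(1)[OF assms(1,2)]
  have nz: "entropy_vars \<gamma> u $ 5 \<noteq> 0"
    using w5 r p by simp
  have "((\<lambda>v. - (L (entropy_vars \<gamma> v) / entropy_vars \<gamma> v $ 5)) has_derivative
      (\<lambda>h. pressure \<gamma> u / density u * (L (W h) + \<phi> u * W h $ 5))) (at u)"
    using r p nz
    by (auto intro!: derivative_eq_intros bounded_linear.has_derivative[OF L W]
        bounded_linear.has_derivative[OF bounded_linear_vec_nth W]
        simp: \<phi>[OF assms(2)] w5 fun_eq_iff field_simps)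
  then have "(\<phi> has_derivative
      (\<lambda>h. pressure \<gamma> u / density u * (L (W h) + \<phi> u * W h $ 5))) (at u)"
    by (rule has_derivative_transform_within_open[OF _ open_admissible[of \<gamma>]])
       (use assms(2) \<phi> in auto)
  then show ?thesis
    unfolding pd_def W_def by (simp add: frechet_derivative_at[symmetric])
qed

text \<open>
  Up to the gas constant the temperature is \<open>- 1 / w\<^sub>5\<close>, so its gradient involves the fifth
  component of \<open>\<nabla>w\<close> alone; this makes the thermal form diagonal.
\<close>

lemma pd_temperature:
  assumes "\<gamma> > 1" and "admissible \<gamma> u" and R: "R \<noteq> 0"
  shows "pd (\<lambda>u. pressure \<gamma> u / (R * density u)) u g l
    = (pressure \<gamma> u / density u)\<^sup>2 / R * pd (entropy_vars \<gamma>) u g l $ 5"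
proof -
  define W where "W = frechet_derivative (entropy_vars \<gamma>) (at u)"
  have W: "(entropy_vars \<gamma> has_derivative W) (at u)"
    using entropy_vars_differentiable[OF assms(1,2)] unfolding W_def frechet_derivative_works .
  have r: "density u > 0" and p: "pressure \<gamma> u > 0"
    using assms(2) by (auto simp: admissible_def)
  note w5 = entropy_vars_primitive(1)[OF assms(1)]
  have nz: "entropy_vars \<gamma> u $ 5 \<noteq> 0"
    using w5[OF assms(2)] r p by simp
  have "((\<lambda>v. - (inverse (entropy_vars \<gamma> v $ 5) / R)) has_derivative
      (\<lambda>h. (pressure \<gamma> u / density u)\<^sup>2 / R * W h $ 5)) (at u)"
    using r p nz R
    by (auto intro!: derivative_eq_intros
        bounded_linear.has_derivative[OF bounded_linear_vec_nth W]
        simp: w5[OF assms(2)] fun_eq_iff field_simps power2_eq_square)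
  then have "((\<lambda>u. pressure \<gamma> u / (R * density u)) has_derivative
      (\<lambda>h. (pressure \<gamma> u / density u)\<^sup>2 / R * W h $ 5)) (at u)"
    by (rule has_derivative_transform_within_open[OF _ open_admissible[of \<gamma>]])
       (use assms(2) w5 in \<open>auto simp: field_simps\<close>)
  then show ?thesis
    unfolding pd_def W_def by (simp add: frechet_derivative_at[symmetric])
qed

lemma block_grad_entropy_vars:
  "block (grad_entropy_vars \<gamma> u g) l = pd (entropy_vars \<gamma>) u g l"
  by (simp add: block_def grad_entropy_vars_def stack_def vec_eq_iff)

lemma bounded_linear_momentum: "bounded_linear (\<lambda>a. momentum a $ k)"
  and bounded_linear_magnetic: "bounded_linear (\<lambda>a. magnetic a $ k)"
  using exhaust_3[of k]
  by (auto simp: momentum_def magnetic_def vector_3 bounded_linear_vec_nth)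

lemma pd_velocity:
  assumes "\<gamma> > 1" and "admissible \<gamma> u"
  shows "pd (\<lambda>u. velocity u $ k) u g l
    = pressure \<gamma> u / density u * vel_grad (velocity u) (grad_entropy_vars \<gamma> u g) l k"
  unfolding vel_grad_def block_grad_entropy_vars
  by (rule pd_quotient_of_entropy_vars[OF assms bounded_linear_momentum])
     (rule entropy_vars_primitive(2)[OF assms(1)])

lemma pd_magnetic:
  assumes "\<gamma> > 1" and "admissible \<gamma> u"
  shows "pd (\<lambda>u. magnetic u $ k) u g l
    = pressure \<gamma> u / density u * mag_grad (magnetic u) (grad_entropy_vars \<gamma> u g) l k"
  unfolding mag_grad_def block_grad_entropy_vars
  by (rule pd_quotient_of_entropy_vars[OF assms bounded_linear_magnetic])
     (rule entropy_vars_primitive(3)[OF assms(1)])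

section \<open>Symmetric positive semi-definite form of the flux\<close>

text \<open>
  The identity \<open>- ((\<nabla> \<times> B) \<times> B)\<^sub>l = \<Sum>\<^sub>k (\<partial>\<^sub>l B\<^sub>k - \<partial>\<^sub>k B\<^sub>l) B\<^sub>k\<close> shows that the Joule term in
  the energy flux is the resistive flux of the magnetic field, multiplied by \<open>B\<close>.
\<close>

lemma cross3_curl_magnetic:
  "- (cross3 (curl_magnetic u g) (magnetic u) $ l)
     = (\<Sum>k\<in>UNIV. skew (\<lambda>l k. pd (\<lambda>u. magnetic u $ k) u g l) l k * magnetic u $ k)"
  using exhaust_3[of l]
  by (auto simp: cross3_def curl_magnetic_def Let_def skew_def sum_3 vector_3 algebra_simps)

text \<open>
  The gradients of \<open>v\<close> and \<open>B\<close> contribute one factor \<open>\<theta> = p / \<rho>\<close>, the gradient of the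
  temperature contributes \<open>\<theta>\<^sup>2 / R\<close>. The three coefficients are positive when the material
  constants are, since \<open>\<rho>\<close> and \<open>p\<close> are.
\<close>

lemma viscous_flux_eq_flux_map:
  fixes u :: "real^9"
  assumes "\<gamma> > 1" and "admissible \<gamma> u" and "R \<noteq> 0"
  defines "\<theta> \<equiv> pressure \<gamma> u / density u"
  shows "viscous_flux \<gamma> \<mu>NS \<mu>R \<kappa> R u g
    = flux_map (\<mu>NS * \<theta>) (\<mu>R * \<theta>) (\<kappa> * \<theta>\<^sup>2 / R) (velocity u) (magnetic u)
        (grad_entropy_vars \<gamma> u g)"
proof -
  let ?q = "grad_entropy_vars \<gamma> u g"
  note dv = pd_velocity[OF assms(1,2), folded \<theta>_def]
  note dB = pd_magnetic[OF assms(1,2), folded \<theta>_def]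
  have stress: "stress \<mu>NS u g l k = \<mu>NS * \<theta> * newtonian (vel_grad (velocity u) ?q) l k" for l k
    by (simp add: stress_def div_velocity_def dv newtonian_def sum_distrib_left[symmetric]
        algebra_simps)
  have resistive: "\<mu>R * (\<theta> * mag_grad (magnetic u) ?q l k - \<theta> * mag_grad (magnetic u) ?q k l)
      = \<mu>R * \<theta> * skew (mag_grad (magnetic u) ?q) l k" for l k
    by (simp add: skew_def algebra_simps)
  have joule: "\<mu>R * cross3 (curl_magnetic u g) (magnetic u) $ l
      = - (\<Sum>k\<in>UNIV. \<mu>R * \<theta> * skew (mag_grad (magnetic u) ?q) l k * magnetic u $ k)" for l
  proof -
    have "\<mu>R * cross3 (curl_magnetic u g) (magnetic u) $ l
        = - (\<mu>R * (\<Sum>k\<in>UNIV. skew (\<lambda>l k. \<theta> * mag_grad (magnetic u) ?q l k) l k * magnetic u $ k))"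
      using cross3_curl_magnetic[of u g l] unfolding dB by (metis add.inverse_inverse mult_minus_right)
    then show ?thesis
      by (simp add: skew_def sum_distrib_left algebra_simps)
  qed
  have "viscous_flux_dir \<gamma> \<mu>NS \<mu>R \<kappa> R u g = (\<lambda>l. vector
      [0, \<mu>NS * \<theta> * newtonian (vel_grad (velocity u) ?q) l 1,
       \<mu>NS * \<theta> * newtonian (vel_grad (velocity u) ?q) l 2,
       \<mu>NS * \<theta> * newtonian (vel_grad (velocity u) ?q) l 3,
       (\<Sum>k\<in>UNIV. \<mu>NS * \<theta> * newtonian (vel_grad (velocity u) ?q) l k * velocity u $ k)
        + \<kappa> * \<theta>\<^sup>2 / R * block ?q l $ 5
        + (\<Sum>k\<in>UNIV. \<mu>R * \<theta> * skew (mag_grad (magnetic u) ?q) l k * magnetic u $ k),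
       \<mu>R * \<theta> * skew (mag_grad (magnetic u) ?q) l 1,
       \<mu>R * \<theta> * skew (mag_grad (magnetic u) ?q) l 2,
       \<mu>R * \<theta> * skew (mag_grad (magnetic u) ?q) l 3, 0])"
    unfolding fun_eq_iff viscous_flux_dir_def Let_def stress dB resistive joule block_grad_entropy_vars
      pd_temperature[OF assms(1,2,3), folded \<theta>_def]
    by (simp add: mult.assoc)
  then show ?thesis
    unfolding viscous_flux_def flux_map_def Let_def by (simp only:)
qed

theorem lemma1:
  fixes \<gamma> \<mu>NS \<mu>R \<kappa> R :: real and u :: "real^9"
  assumes "\<gamma> > 1" and "\<mu>NS > 0" and "\<mu>R > 0" and "\<kappa> > 0" and "R > 0"
    and "admissible \<gamma> u"
  shows "\<exists>K :: real^(3 \<times> 9)^(3 \<times> 9).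
    (\<forall>g :: real^9^3. viscous_flux \<gamma> \<mu>NS \<mu>R \<kappa> R u g = K *v grad_entropy_vars \<gamma> u g)
    \<and> K = transpose K
    \<and> (\<forall>q :: real^(3 \<times> 9). q \<bullet> (K *v q) \<ge> 0)"
proof -
  define \<theta> where "\<theta> = pressure \<gamma> u / density u"
  let ?F = "flux_map (\<mu>NS * \<theta>) (\<mu>R * \<theta>) (\<kappa> * \<theta>\<^sup>2 / R) (velocity u) (magnetic u)"
  have "\<theta> > 0"
    using assms(6) by (simp add: \<theta>_def admissible_def)
  then have "q \<bullet> ?F q \<ge> 0" for q
    using assms by (intro flux_map_nonneg) auto
  then obtain K where K: "\<forall>q. K *v q = ?F q" "K = transpose K" "\<forall>q. q \<bullet> (K *v q) \<ge> 0"
    using psd_matrix_of_self_adjoint[of ?F, OF flux_map_self_adjoint] by blast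
  have "viscous_flux \<gamma> \<mu>NS \<mu>R \<kappa> R u g = K *v grad_entropy_vars \<gamma> u g" for g
    using viscous_flux_eq_flux_map[OF assms(1,6), of R] assms(5) K(1) unfolding \<theta>_def by simp
  with K(2,3) show ?thesis by blast
qed

end
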